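(* Let $\ell \in \mathbb{N}$ be odd and let $s\ge 0$ be the integer with $3^{s}\,\|\,\ell$. Then for every $k\in\mathbb{N}$, $$\sum_{d \mid 3k+2} \left(\frac{d}{3}\right) d^{2\ell} \equiv 0 \pmod{3^{s+1}}, \qquad \sum_{d \mid 3k+1} \left(\frac{d}{3}\right) d^{2\ell} \equiv c_{3}(k) \pmod{3^{s+1}},$$ $$\sum_{d \mid 3k+2} d^{\ell} \equiv 0 \pmod{3^{s+1}}, \qquad \sum_{d \mid 3k+1} d^{\ell} \equiv c_{3}(k) \pmod{3^{s+1}},$$ where all sums run over positive divisors.
   Context: $\left(\frac{\cdot}{3}\right)$ is the Jacobi (Legendre) symbol modulo $3$. The notation $3^s\,\|\,\ell$ means $3^s\mid \ell$ and $3^{s+1}\nmid \ell$. $c_3(k)$ is the number of $3$-core partitions of $k$, i.e. the number of partitions of $k$ such that no hook number in the Ferrers graph is divisible by $3$. *)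

theory Defs
  imports "HOL-Number_Theory.Number_Theory"
begin

definition partitions :: "nat \<Rightarrow> nat list set" where
  "partitions n = {xs. sorted_wrt (\<ge>) xs \<and> 0 \<notin> set xs \<and> sum_list xs = n}"

text \<open>Rows and columns of the Ferrers graph are numbered from \<open>0\<close>, so row \<open>i\<close> consists of the
  cells \<open>(i, j)\<close> with \<open>j < xs ! i\<close>.\<close>

definition ferrers :: "nat list \<Rightarrow> (nat \<times> nat) set" where
  "ferrers xs = {(i, j). i < length xs \<and> j < xs ! i}"

text \<open>The hook of a cell consists of the cell itself, the cells to its right in the same row, and
  the cells below it in the same column.\<close>

definition hook :: "nat list \<Rightarrow> nat \<times> nat \<Rightarrow> (nat \<times> nat) set" where
  "hook xs c = {(i, j) \<in> ferrers xs. i = fst c \<and> snd c \<le> j \<or> fst c \<le> i \<and> j = snd c}"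

definition hook_number :: "nat list \<Rightarrow> nat \<times> nat \<Rightarrow> nat" where
  "hook_number xs c = card (hook xs c)"

definition is_core :: "nat \<Rightarrow> nat list \<Rightarrow> bool" where
  "is_core t xs \<longleftrightarrow> (\<forall>c\<in>ferrers xs. \<not> t dvd hook_number xs c)"

definition core_count :: "nat \<Rightarrow> nat \<Rightarrow> nat" where
  "core_count t n = card {xs \<in> partitions n. is_core t xs}"

lemma finite_partitions: "finite (partitions n)"
proof (rule finite_subset)
  have len: "length xs \<le> sum_list xs" if "0 \<notin> set xs" for xs :: "nat list"
    using that by (induction xs) auto
  show "partitions n \<subseteq> {xs. set xs \<subseteq> {..n} \<and> length xs \<le> n}"
    using len member_le_sum_list by (fastforce simp: partitions_def)
  show "finite {xs. set xs \<subseteq> {..n} \<and> length xs \<le> n}"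
    by (rule finite_lists_length_le) simp
qed

lemma finite_ferrers: "finite (ferrers xs)"
proof (rule finite_subset)
  show "ferrers xs \<subseteq> (SIGMA i:{..<length xs}. {..<xs ! i})"
    by (auto simp: ferrers_def)
qed auto

end

theory Submission
  imports Defs "HOL-Library.Discrete_Functions"
begin

text \<open>
  Write \<open>\<chi>\<close> for the Legendre symbol modulo 3. All divisors \<open>d\<close> that occur are coprime to 3. Since
  \<open>x \<equiv> y\<close> modulo 3 implies \<open>x ^ 3 ^ s \<equiv> y ^ 3 ^ s\<close> modulo \<open>3 ^ (s + 1)\<close>, and \<open>l\<close> is an odd multiple
  of \<open>3 ^ s\<close>, one gets \<open>d ^ l \<equiv> \<chi> d\<close> and \<open>d ^ (2 * l) \<equiv> 1\<close> modulo \<open>3 ^ (s + 1)\<close>. So all four sums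
  are congruent to \<open>g n = (\<Sum>d | d dvd n. \<chi> d)\<close>, called \<open>char_sum\<close> below, with \<open>n = 3 * k + 2\<close> or
  \<open>n = 3 * k + 1\<close>. In the first case \<open>d \<mapsto> n div d\<close> changes the sign of every summand, and \<open>g n = 0\<close>.
  It remains to see that the number of 3-cores of \<open>k\<close> equals \<open>g (3 * k + 1)\<close>; this is an equality,
  not only a congruence (\<open>core_count_3_eq_char_sum\<close>).

  Up to a factor 3, both numbers count Eisenstein integers. A partition with \<open>m\<close> parts is encoded by its beta set, the
  set of its first-column hook lengths. The hook lengths in a row are the differences \<open>b - c\<close>, where
  \<open>b\<close> is the element of the beta set belonging to the row and \<open>c < b\<close> runs through the gaps of the
  beta set. Hence a partition is a 3-core iff its beta set is closed under \<open>b \<mapsto> b - 3\<close>, that is,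
  iff it consists of the first \<open>u\<close> numbers congruent to 1 and the first \<open>v\<close> numbers congruent to 2
  modulo 3. The size of that partition is \<open>u\<^sup>2 + v\<^sup>2 + v - u * v\<close> (\<open>core_count_3\<close>). The substitution
  \<open>a = u + v + 1\<close>, \<open>b = 2 * u - v\<close> turns the condition that the size be \<open>k\<close> into
  \<open>a\<^sup>2 - a * b + b\<^sup>2 = 3 * k + 1\<close>, and the pairs \<open>(u, v)\<close> correspond to the \<open>a + b * \<omega>\<close> of norm
  \<open>3 * k + 1\<close> which lie in a sector of angle \<open>2 * \<pi> / 3\<close> and are 1 modulo \<open>\<surd>-3\<close>. Multiplication by the
  cube root of unity \<open>\<omega>\<close> moves the sector around, so there are three times as many elements of that
  norm and residue in the whole plane.

  Let \<open>F n\<close> be the number of Eisenstein integers of norm \<open>n\<close> that are 1 modulo \<open>\<surd>-3\<close>. Then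
  \<open>F n = 3 * g n\<close> whenever 3 does not divide \<open>n\<close> (\<open>card_eis_class\<close>), because for every prime
  \<open>p \<noteq> 3\<close> both \<open>F\<close> and \<open>g\<close> satisfy the recurrence
  \<open>h (p * n) = (1 + \<chi> p) * h n - \<chi> p * h (n / p)\<close>, the last term being absent if \<open>p\<close> does not divide
  \<open>n\<close>. For \<open>g\<close> this is inclusion-exclusion on divisors. For \<open>F\<close> it is unique factorisation in a form
  that can be checked by hand: if \<open>p \<equiv> 2\<close> modulo 3, then \<open>p\<close> divides every element whose norm it
  divides; if \<open>p \<equiv> 1\<close>, then \<open>p\<close> is the norm of some \<open>\<pi>\<close> by Thue's lemma, every element of norm
  \<open>p * n\<close> is divisible by \<open>\<pi>\<close> or by its conjugate, and those divisible by both are the multiples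
  of \<open>p\<close>.
\<close>

section \<open>The quadratic character modulo 3 and its divisor sum\<close>

lemma Legendre_3: "Legendre a 3 = (if a mod 3 = 0 then 0 else if a mod 3 = 1 then 1 else - 1)"
proof -
  have "QuadRes 3 a" if "a mod 3 = 1"
    unfolding QuadRes_def using that by (intro exI[of _ 1]) (simp add: cong_def)
  moreover have "\<not> QuadRes 3 a" if "a mod 3 = 2"
  proof
    assume "QuadRes 3 a"
    then obtain y where y: "y ^ 2 mod 3 = a mod 3"
      by (auto simp: QuadRes_def cong_def)
    have "y mod 3 = 0 \<or> y mod 3 = 1 \<or> y mod 3 = 2" by presburger
    then have "(y mod 3) ^ 2 mod 3 = 0 \<or> (y mod 3) ^ 2 mod 3 = 1" by auto
    then show False using y that by (simp add: power_mod)
  qed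
  ultimately show ?thesis
    using pos_mod_bound[of 3 a] pos_mod_sign[of 3 a]
    by (cases "a mod 3 = 0"; cases "a mod 3 = 1"; cases "a mod 3 = 2")
       (simp_all add: Legendre_def cong_def)
qed

lemma Legendre_3_mult: "Legendre (a * b) 3 = Legendre a 3 * Legendre b 3"
proof -
  have "a mod 3 = 0 \<or> a mod 3 = 1 \<or> a mod 3 = 2" "b mod 3 = 0 \<or> b mod 3 = 1 \<or> b mod 3 = 2"
    by presburger+
  then show ?thesis
    unfolding Legendre_3 mod_mult_eq[of a 3 b, symmetric]
    by (elim disjE; simp only: mult_zero_left mult_zero_right; simp)
qed

text \<open>Each cubing gains a factor 3: in \<open>u ^ 3 - v ^ 3 = (u - v) * (u\<^sup>2 + u * v + v\<^sup>2)\<close> the second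
  factor is \<open>3 * v\<^sup>2\<close> modulo 3 if \<open>u \<equiv> v\<close> modulo 3.\<close>

lemma cong_power_3_power:
  fixes x y :: int
  assumes "[x = y] (mod 3)"
  shows "[x ^ 3 ^ s = y ^ 3 ^ s] (mod 3 ^ (s + 1))"
proof (induction s)
  case 0
  then show ?case using assms by simp
next
  case (Suc s)
  define u v where "u = x ^ 3 ^ s" and "v = y ^ 3 ^ s"
  have uv: "3 ^ (s + 1) dvd u - v"
    using Suc by (simp add: u_def v_def cong_iff_dvd_diff)
  then have "3 dvd u - v" by (rule dvd_trans[rotated]) simp
  then obtain w where "u = v + 3 * w" by (metis add_diff_cancel_left' dvd_def diff_add_cancel add.commute)
  then have "u\<^sup>2 + u * v + v\<^sup>2 = 3 * (v\<^sup>2 + 3 * v * w + 3 * w\<^sup>2)"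
    by (simp add: power2_eq_square algebra_simps)
  then have "3 ^ (s + 1) * 3 dvd (u - v) * (u\<^sup>2 + u * v + v\<^sup>2)"
    using uv by (metis dvd_triv_left mult_dvd_mono)
  also have "(u - v) * (u\<^sup>2 + u * v + v\<^sup>2) = u ^ 3 - v ^ 3"
    by (simp add: power2_eq_square power3_eq_cube algebra_simps)
  also have "u ^ 3 - v ^ 3 = x ^ 3 ^ Suc s - y ^ 3 ^ Suc s"
    by (simp add: u_def v_def mult.commute flip: power_mult)
  finally show ?case by (simp add: cong_iff_dvd_diff mult.commute)
qed

lemma odd_power_cong_Legendre_3:
  fixes d l s :: nat
  assumes "odd l" "3 ^ s dvd l" "\<not> 3 dvd d"
  shows "[int d ^ l = Legendre (int d) 3] (mod 3 ^ (s + 1))"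
    and "[int d ^ (2 * l) = 1] (mod 3 ^ (s + 1))"
proof -
  obtain m where m: "l = 3 ^ s * m" using assms by blast
  then have "odd m" using assms by auto
  define c where "c = Legendre (int d) 3"
  have "int d mod 3 = 1 \<or> int d mod 3 = 2" using assms(3) by presburger
  then have c: "c = 1 \<or> c = -1" and dc: "[int d = c] (mod 3)"
    by (auto simp: c_def Legendre_3 cong_def)
  from cong_power_3_power[OF dc] have "[(int d ^ 3 ^ s) ^ m = (c ^ 3 ^ s) ^ m] (mod 3 ^ (s + 1))"
    by (rule cong_pow)
  moreover have "(c ^ 3 ^ s) ^ m = c" using c \<open>odd m\<close> by auto
  ultimately show *: "[int d ^ l = Legendre (int d) 3] (mod 3 ^ (s + 1))"
    by (simp add: m power_mult c_def)
  have "[(int d ^ l) ^ 2 = c ^ 2] (mod 3 ^ (s + 1))"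
    using * unfolding c_def by (rule cong_pow)
  then show "[int d ^ (2 * l) = 1] (mod 3 ^ (s + 1))"
    using c by (auto simp: power_mult mult.commute)
qed

definition char_sum :: "nat \<Rightarrow> int" where
  "char_sum n = (\<Sum>d | d dvd n. Legendre (int d) 3)"

lemma char_sum_1: "char_sum 1 = 1"
  by (simp add: char_sum_def Legendre_3)

text \<open>Complementary divisors have opposite characters, since \<open>\<chi> d * \<chi> (n div d) = \<chi> n = -1\<close>.\<close>

lemma char_sum_eq_0:
  assumes "n mod 3 = 2"
  shows "char_sum n = 0"
proof -
  have "n > 0" using assms by (cases n) auto
  have "char_sum n = (\<Sum>d | d dvd n. Legendre (int (n div d)) 3)"
    unfolding char_sum_def using \<open>n > 0\<close>
    by (intro sum.reindex_bij_witness[of _ "\<lambda>d. n div d" "\<lambda>d. n div d"])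
       (auto simp: div_div_eq_right)
  also have "\<dots> = (\<Sum>d | d dvd n. - Legendre (int d) 3)"
  proof (rule sum.cong)
    fix d assume "d \<in> {d. d dvd n}"
    then have "Legendre (int d) 3 * Legendre (int (n div d)) 3 = Legendre (int n) 3"
      by (simp flip: Legendre_3_mult of_nat_mult)
    moreover have "int n mod 3 = 2" using assms by presburger
    then have "Legendre (int n) 3 = -1" by (simp add: Legendre_3)
    moreover have "Legendre (int d) 3 \<in> {0, 1, -1}" by (simp add: Legendre_3)
    ultimately show "Legendre (int (n div d)) 3 = - Legendre (int d) 3" by fastforce
  qed simp
  finally show ?thesis by (simp add: char_sum_def sum_negf)
qed

text \<open>A divisor of \<open>p * n\<close> is a divisor of \<open>n\<close> or \<open>p\<close> times one; the divisors of both kinds are \<open>p\<close>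
  times the divisors of \<open>n div p\<close>. The correction term lets the induction in
  \<open>card_eis_class\<close> remove one prime factor at a time instead of a prime power.\<close>

lemma char_sum_prime_mult:
  assumes p: "prime p" and "n > 0"
  shows "char_sum (p * n) = (1 + Legendre (int p) 3) * char_sum n
           - Legendre (int p) 3 * (if p dvd n then char_sum (n div p) else 0)"
proof -
  let ?D = "\<lambda>n. {d. d dvd n}"
  let ?f = "\<lambda>d. Legendre (int d) 3"
  have p0: "p > 0" using p by (simp add: prime_gt_0_nat)
  have fin: "finite (?D n)" using \<open>n > 0\<close> by simp
  have scale: "sum ?f ((*) p ` S) = ?f p * sum ?f S" for S
    using p0 by (subst sum.reindex) (auto simp: inj_on_def Legendre_3_mult sum_distrib_left)
  have un: "?D (p * n) = ?D n \<union> (*) p ` ?D n"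
  proof (intro equalityI subsetI)
    fix d assume d: "d \<in> ?D (p * n)"
    show "d \<in> ?D n \<union> (*) p ` ?D n"
    proof (cases "p dvd d")
      case True
      then show ?thesis using d p0 by (auto elim!: dvdE)
    next
      case False
      then have "coprime d p" using p by (metis coprime_commute prime_imp_coprime)
      then show ?thesis using d by (simp add: coprime_dvd_mult_right_iff)
    qed
  qed auto
  have int: "sum ?f (?D n \<inter> (*) p ` ?D n)
      = ?f p * (if p dvd n then char_sum (n div p) else 0)"
  proof (cases "p dvd n")
    case True
    then obtain m where m: "n = p * m" by blast
    have "?D n \<inter> (*) p ` ?D n = (*) p ` ?D m"
      using p0 by (auto simp: m)
    then show ?thesis using p0 by (simp add: scale m char_sum_def)
  next
    case False
    then have "?D n \<inter> (*) p ` ?D n = {}" by (auto dest: dvd_mult_left)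
    then show ?thesis using False by simp
  qed
  have "char_sum (p * n) = sum ?f (?D n) + sum ?f ((*) p ` ?D n) - sum ?f (?D n \<inter> (*) p ` ?D n)"
    unfolding char_sum_def un using fin by (intro sum_Un) auto
  then show ?thesis
    unfolding scale int unfolding char_sum_def by (simp add: distrib_right)
qed

section \<open>Eisenstein integers\<close>

text \<open>The pair \<open>(a, b)\<close> stands for \<open>a + b * \<omega>\<close>, where \<open>\<omega>\<close> is a primitive cube root of unity, so
  \<open>\<omega>\<^sup>2 = - 1 - \<omega>\<close>. This determines the formulas for the product, the conjugate and the norm.\<close>

definition eis_norm :: "int \<times> int \<Rightarrow> int" where
  "eis_norm = (\<lambda>(a, b). a\<^sup>2 - a * b + b\<^sup>2)"

definition eis_mult :: "int \<times> int \<Rightarrow> int \<times> int \<Rightarrow> int \<times> int" where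
  "eis_mult = (\<lambda>(a, b) (c, d). (a * c - b * d, a * d + b * c - b * d))"

definition eis_cnj :: "int \<times> int \<Rightarrow> int \<times> int" where
  "eis_cnj = (\<lambda>(a, b). (a - b, - b))"

text \<open>Reduction modulo the prime element \<open>\<surd>-3 = 1 + 2 * \<omega>\<close>: the residue field has three elements and
  \<open>\<omega>\<close> is sent to 1, so this is a ring homomorphism to the integers modulo 3.\<close>

definition eis_res :: "int \<times> int \<Rightarrow> int" where
  "eis_res = (\<lambda>(a, b). (a + b) mod 3)"

text \<open>Fixing the residue selects one of \<open>z\<close> and \<open>- z\<close> for each \<open>z\<close> of norm coprime to 3, and it is
  compatible with multiplication. The factor 3 that remains comes from the powers of \<open>\<omega>\<close>.\<close>

definition eis_class :: "nat \<Rightarrow> (int \<times> int) set" where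
  "eis_class n = {z. eis_norm z = int n \<and> eis_res z = 1}"

lemma eis_norm_mult: "eis_norm (eis_mult z w) = eis_norm z * eis_norm w"
  by (cases z; cases w)
     (simp add: eis_norm_def eis_mult_def power2_eq_square algebra_simps)

lemma eis_mult_assoc: "eis_mult (eis_mult u v) w = eis_mult u (eis_mult v w)"
  by (cases u; cases v; cases w) (simp add: eis_mult_def algebra_simps)

lemma eis_mult_cnj: "eis_mult (eis_cnj z) z = (eis_norm z, 0)" "eis_mult z (eis_cnj z) = (eis_norm z, 0)"
  by (cases z; simp add: eis_norm_def eis_mult_def eis_cnj_def power2_eq_square algebra_simps)+

lemma eis_norm_cnj: "eis_norm (eis_cnj z) = eis_norm z"
  by (cases z) (simp add: eis_norm_def eis_cnj_def power2_eq_square algebra_simps)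

lemma eis_res_mult: "eis_res z = 1 \<Longrightarrow> eis_res (eis_mult z w) = eis_res w"
proof -
  assume z: "eis_res z = 1"
  obtain a b c d where zw: "z = (a, b)" "w = (c, d)" by (metis surj_pair)
  have "a * c - b * d + (a * d + b * c - b * d) = (a + b) * (c + d) - 3 * (b * d)"
    by (simp add: algebra_simps)
  also have "[\<dots> = (a + b) * (c + d) - 0] (mod 3)"
    by (intro cong_diff cong_refl) (simp add: cong_def)
  also have "[(a + b) * (c + d) - 0 = 1 * (c + d) - 0] (mod 3)"
    using z by (intro cong_diff cong_mult cong_refl) (simp add: eis_res_def zw cong_def)
  finally show ?thesis by (simp add: eis_res_def eis_mult_def zw cong_def)
qed

lemma eis_res_cnj: "eis_res (eis_cnj z) = eis_res z"
proof (cases z)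
  case (Pair a b)
  have "(a - b + - b) mod 3 = (a + b) mod 3" by presburger
  then show ?thesis by (simp add: Pair eis_cnj_def eis_res_def)
qed

lemma eis_norm_four: "4 * eis_norm (a, b) = (2 * a - b)\<^sup>2 + 3 * b\<^sup>2"
  by (simp add: eis_norm_def power2_eq_square algebra_simps)

lemma finite_eis_class: "finite (eis_class n)"
proof (rule finite_subset)
  show "eis_class n \<subseteq> {- 4 * int n..4 * int n} \<times> {- 4 * int n..4 * int n}"
  proof clarify
    fix a b assume "(a, b) \<in> eis_class n"
    then have N: "eis_norm (a, b) = int n" by (simp add: eis_class_def)
    have "(2 * b - a)\<^sup>2 + 3 * a\<^sup>2 = 4 * int n" "(2 * a - b)\<^sup>2 + 3 * b\<^sup>2 = 4 * int n"
      using N by (simp_all add: eis_norm_def power2_eq_square algebra_simps)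
    then have "a\<^sup>2 \<le> 4 * int n" "b\<^sup>2 \<le> 4 * int n"
      by (smt (verit) zero_le_power2)+
    moreover have "\<bar>x\<bar> \<le> x\<^sup>2" for x :: int
      using abs_le_square_iff[of 1 x] self_le_power[of "\<bar>x\<bar>" 2] by (cases "x = 0") auto
    ultimately show "a \<in> {- 4 * int n..4 * int n} \<and> b \<in> {- 4 * int n..4 * int n}"
      by (smt (verit) atLeastAtMost_iff)
  qed
qed simp

lemma eis_norm_eq_0: "eis_norm z = 0 \<Longrightarrow> z = (0, 0)"
proof (cases z)
  case (Pair a b)
  assume "eis_norm z = 0"
  then have "(2 * a - b)\<^sup>2 + 3 * b\<^sup>2 = 0" using eis_norm_four[of a b] Pair by simp
  then have "(2 * a - b)\<^sup>2 = 0" "b\<^sup>2 = 0"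
    using zero_le_power2[of "2 * a - b"] zero_le_power2[of b] by linarith+
  then show ?thesis using Pair by simp
qed

lemma inj_eis_mult: "eis_norm z \<noteq> 0 \<Longrightarrow> inj (eis_mult z)"
proof (rule injI)
  fix u v assume z: "eis_norm z \<noteq> 0" and "eis_mult z u = eis_mult z v"
  then have "eis_mult (eis_mult (eis_cnj z) z) u = eis_mult (eis_mult (eis_cnj z) z) v"
    by (simp add: eis_mult_assoc)
  then show "u = v" using z unfolding eis_mult_cnj
    by (cases u; cases v) (simp add: eis_mult_def)
qed

text \<open>Divisibility by \<open>\<pi> = c + d * \<omega>\<close> of prime norm \<open>p\<close>: the second coordinate of the conjugate of \<open>\<pi>\<close>
  times \<open>a + b * \<omega>\<close> is \<open>b * c - a * d\<close>. If \<open>p\<close> divides it, then \<open>p\<close> also divides the first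
  coordinate, and dividing the product by \<open>p\<close> gives the quotient of \<open>a + b * \<omega>\<close> by \<open>\<pi>\<close>.\<close>

lemma eis_prime_dvd:
  fixes p :: int
  assumes p: "prime p" and N: "eis_norm (c, d) = p" and dvd: "p dvd b * c - a * d"
  shows "\<exists>w. (a, b) = eis_mult (c, d) w"
proof -
  have N': "c\<^sup>2 - c * d + d\<^sup>2 = p" using N by (simp add: eis_norm_def)
  have "\<not> p dvd c"
  proof
    assume "p dvd c"
    then have "p dvd d\<^sup>2" using N'
      by (metis dvd_add_right_iff dvd_diff dvd_mult2 dvd_refl power2_eq_square)
    then have "p dvd d" using p by (simp add: prime_dvd_power_iff)
    obtain c' d' where "c = p * c'" "d = p * d'" using \<open>p dvd c\<close> \<open>p dvd d\<close> by blast
    then have "p * (p * (c'\<^sup>2 - c' * d' + d'\<^sup>2)) = p * 1"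
      using N' by (simp add: power2_eq_square algebra_simps)
    then have "p dvd 1" using p by (metis dvd_triv_left mult_cancel_left not_prime_0)
    then show False using p by auto
  qed
  have "c * (a * c - a * d + b * d) = a * (c\<^sup>2 - c * d + d\<^sup>2) + d * (b * c - a * d)"
    by (simp add: power2_eq_square algebra_simps)
  also have "p dvd \<dots>" using dvd unfolding N' by simp
  finally have "p dvd a * c - a * d + b * d"
    using p \<open>\<not> p dvd c\<close> by (simp add: prime_dvd_mult_iff)
  then obtain e f where e: "a * c - a * d + b * d = p * e" and f: "b * c - a * d = p * f"
    using dvd by (auto elim!: dvdE)
  have "eis_mult (p, 0) (a, b) = eis_mult (p, 0) (eis_mult (c, d) (e, f))"
  proof -
    have "eis_mult (c, d) (eis_mult (eis_cnj (c, d)) (a, b)) = eis_mult (p, 0) (a, b)"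
      by (simp add: eis_mult_cnj N flip: eis_mult_assoc)
    moreover have "eis_mult (eis_cnj (c, d)) (a, b) = eis_mult (p, 0) (e, f)"
      using e f by (simp add: eis_mult_def eis_cnj_def algebra_simps)
    moreover have "eis_mult (c, d) (eis_mult (p, 0) w) = eis_mult (p, 0) (eis_mult (c, d) w)" for w
      by (cases w) (simp add: eis_mult_def algebra_simps)
    ultimately show ?thesis by simp
  qed
  moreover have "p \<noteq> 0" using p by auto
  ultimately show ?thesis
    by (auto simp: eis_mult_def intro!: exI[of _ "(e, f)"])
qed

section \<open>Rational primes in the Eisenstein integers\<close>

text \<open>Thue's lemma: there are more than \<open>p\<close> pairs \<open>(x, y)\<close> with entries between 0 and the integer
  square root of \<open>p\<close>, so two of them give the same value of \<open>x - t * y\<close> modulo \<open>p\<close>; take their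
  difference. The bounds are strict because a prime is not a square.\<close>

lemma thue:
  fixes t :: int
  assumes p: "prime p"
  shows "\<exists>x y. (x, y) \<noteq> (0, 0) \<and> x\<^sup>2 < int p \<and> y\<^sup>2 < int p \<and> int p dvd x - t * y"
proof -
  define r where "r = floor_sqrt p"
  have "r\<^sup>2 \<noteq> p" using p by (auto simp: prime_power_iff)
  then have r: "r\<^sup>2 < p" using floor_sqrt_power2_le[of p] by (simp add: r_def le_neq_implies_less)
  have p': "p < (Suc r)\<^sup>2" using Suc_floor_sqrt_power2_gt[of p] by (simp add: r_def)
  have p0: "p > 0" using p by (simp add: prime_gt_0_nat)
  define A where "A = {0..int r} \<times> {0..int r}"
  define f where "f = (\<lambda>(x, y). (x - t * y) mod int p)"
  have "f ` A \<subseteq> {0..<int p}" using p0 by (auto simp: f_def)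
  then have "card (f ` A) \<le> p" using card_mono[of "{0..<int p}" "f ` A"] by simp
  also have "p < card A" using p' by (simp add: A_def power2_eq_square nat_add_distrib)
  finally have "\<not> inj_on f A" by (rule pigeonhole)
  then obtain x y x' y' where xy: "(x, y) \<in> A" "(x', y') \<in> A" "(x, y) \<noteq> (x', y')"
    and eq: "f (x, y) = f (x', y')"
    unfolding inj_on_def by auto
  have small: "(u - v)\<^sup>2 < int p" if "u \<in> {0..int r}" "v \<in> {0..int r}" for u v
  proof -
    have "\<bar>u - v\<bar> \<le> \<bar>int r\<bar>" using that by auto
    then have "(u - v)\<^sup>2 \<le> (int r)\<^sup>2" by (simp only: abs_le_square_iff)
    also have "\<dots> < int p" using r by (simp flip: of_nat_power)
    finally show ?thesis .
  qed
  have "int p dvd (x - t * y) - (x' - t * y')"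
    using eq by (simp add: f_def mod_eq_dvd_iff)
  then have "int p dvd (x - x') - t * (y - y')" by (simp add: algebra_simps)
  then show ?thesis
    using xy small by (intro exI[of _ "x - x'"] exI[of _ "y - y'"]) (auto simp: A_def)
qed

text \<open>A power \<open>w\<close> of a primitive root has order 3 modulo \<open>p\<close>, so \<open>w\<^sup>2 + w + 1\<close> vanishes modulo \<open>p\<close>;
  then \<open>- w\<close> has order 6.\<close>

lemma ex_primitive_sixth_root:
  assumes p: "prime p" and mod: "p mod 3 = 1"
  shows "\<exists>t. int p dvd t\<^sup>2 - t + 1"
proof -
  have p1: "p > 1" using p by (rule prime_gt_1_nat)
  obtain g where "residue_primroot p g"
    using prime_primitive_root_exists[of p] p p1 by auto
  then have ord: "ord p g = p - 1" using p by (simp add: residue_primroot_def totient_prime)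
  obtain m where m: "p - 1 = 3 * m" "m > 0"
  proof
    show "p - 1 = 3 * (p div 3)" "p div 3 > 0" using mod p1 by presburger+
  qed
  define w where "w = int (g ^ m)"
  have "[g ^ (3 * m) = 1] (mod p)" by (simp add: ord_divides ord m del: One_nat_def)
  moreover have "g ^ (3 * m) = g ^ m * (g ^ m) ^ 2"
    by (simp add: power_mult mult.commute[of 3] power3_eq_cube power2_eq_square)
  ultimately have "[g ^ m * (g ^ m) ^ 2 = 1] (mod p)" by simp
  then have "[int (g ^ m * (g ^ m) ^ 2) = int 1] (mod int p)" by (simp only: cong_int_iff)
  then have "[w * w ^ 2 = 1] (mod int p)" by (simp add: w_def)
  then have "int p dvd (w - 1) * (w ^ 2 + w + 1)"
    by (simp add: cong_iff_dvd_diff algebra_simps power2_eq_square)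
  moreover have "\<not> int p dvd w - 1"
  proof
    assume "int p dvd w - 1"
    then have "[int (g ^ m) = int 1] (mod int p)" by (simp add: w_def cong_iff_dvd_diff)
    then have "[g ^ m = 1] (mod p)" by (simp only: cong_int_iff)
    then have "p - 1 dvd m" by (simp add: ord_divides ord del: One_nat_def)
    then show False using m by (auto dest: dvd_imp_le)
  qed
  ultimately have "int p dvd w ^ 2 + w + 1"
    using p by (simp add: prime_dvd_mult_iff)
  then show ?thesis by (intro exI[of _ "- w"]) simp
qed

lemma eis_norm_mod_3: "[eis_norm (a, b) = (a + b)\<^sup>2] (mod 3)"
proof -
  have "eis_norm (a, b) - (a + b)\<^sup>2 = 3 * (- a * b)"
    by (simp add: eis_norm_def power2_eq_square algebra_simps)
  then show ?thesis unfolding cong_iff_dvd_diff by simp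
qed

text \<open>Thue's lemma for a root \<open>t\<close> of \<open>t\<^sup>2 - t + 1\<close> gives a nonzero Eisenstein integer whose norm is a
  multiple of \<open>p\<close> below \<open>3 * p\<close>. The norm cannot be \<open>2 * p\<close>: an even norm is divisible by 4. The
  sign of the element can be chosen so that its residue becomes 1.\<close>

lemma split_prime_eis_class:
  assumes p: "prime p" and mod: "p mod 3 = 1"
  shows "\<exists>z. z \<in> eis_class p"
proof -
  obtain t where t: "int p dvd t\<^sup>2 - t + 1" using ex_primitive_sixth_root[OF assms] by blast
  obtain x y where xy: "(x, y) \<noteq> (0, 0)" "x\<^sup>2 < int p" "y\<^sup>2 < int p" "int p dvd x - t * y"
    using thue[OF p] by blast
  define N where "N = eis_norm (x, y)"
  \<comment> \<open>modulo \<open>p\<close> the norm form splits into linear factors with the roots \<open>t\<close> and \<open>1 - t\<close>\<close>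
  have "N = (x - t * y) * (x + t * y - y) + (t\<^sup>2 - t + 1) * y\<^sup>2"
    by (simp add: N_def eis_norm_def power2_eq_square algebra_simps)
  then have "int p dvd N" using t xy(4) by simp
  then obtain q where q: "N = int p * q" by blast
  have "4 * N = (2 * x - y)\<^sup>2 + 3 * y\<^sup>2" by (simp add: N_def eis_norm_four)
  then have "N \<ge> 0" using zero_le_power2[of "2 * x - y"] zero_le_power2[of y] by linarith
  moreover have "N \<noteq> 0" using eis_norm_eq_0[of "(x, y)"] xy(1) by (auto simp: N_def)
  moreover have "N < 3 * int p"
  proof -
    \<comment> \<open>this bounds \<open>N\<close> by \<open>3 / 2 * (x\<^sup>2 + y\<^sup>2)\<close>\<close>
    have "2 * N = 3 * x\<^sup>2 + 3 * y\<^sup>2 - (x + y)\<^sup>2"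
      by (simp add: N_def eis_norm_def power2_eq_square algebra_simps)
    then show ?thesis using xy(2,3) zero_le_power2[of "x + y"] by linarith
  qed
  ultimately have "0 < q \<and> q < 3" using q prime_gt_0_nat[OF p]
    by (auto simp: mult.commute[of "int p"] zero_le_mult_iff)
  moreover have "q \<noteq> 2"
  proof
    assume "q = 2"
    then have "even N" using q by simp
    then have "even x \<and> even y" by (auto simp: N_def eis_norm_def)
    then obtain u v where "x = 2 * u" "y = 2 * v" by blast
    then have "N = 4 * eis_norm (u, v)" by (simp add: N_def eis_norm_def power2_eq_square algebra_simps)
    then have "2 * eis_norm (u, v) = int p" using q \<open>q = 2\<close> by simp
    then have "even p" by (metis dvd_triv_left even_of_nat)
    then have "p = 2" using p primes_dvd_imp_eq[of 2 p] by simp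
    then show False using mod by simp
  qed
  ultimately have N: "eis_norm (x, y) = int p" using q by (simp add: N_def)
  have "[(x + y)\<^sup>2 = int p] (mod 3)" using eis_norm_mod_3[of x y] by (simp add: N cong_sym)
  moreover have "\<not> 3 dvd int p" using mod by presburger
  ultimately have "\<not> 3 dvd x + y"
    by (metis cong_dvd_iff dvd_mult2 power2_eq_square)
  then have "(x + y) mod 3 = 1 \<or> (- x + - y) mod 3 = 1" by presburger
  then consider "(x + y) mod 3 = 1" | "(- x + - y) mod 3 = 1" by blast
  then show ?thesis
  proof cases
    case 1
    then show ?thesis using N by (intro exI[of _ "(x, y)"]) (simp add: eis_class_def eis_res_def)
  next
    case 2
    then show ?thesis using N minus_diff_commute[of x y]
      by (intro exI[of _ "(- x, - y)"]) (simp add: eis_class_def eis_res_def eis_norm_def)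
  qed
qed

text \<open>With \<open>p = 3 * m + 2\<close>, cubing is injective modulo \<open>p\<close> because of Fermat's theorem: the exponent
  \<open>p - 1\<close> is \<open>3 * m + 1\<close>. As \<open>a ^ 3 + b ^ 3 = (a + b) * (a\<^sup>2 - a * b + b\<^sup>2)\<close>, the assumption would
  force \<open>a \<equiv> - b\<close> for units \<open>a\<close> and \<open>b\<close>, and then \<open>p\<close> would divide \<open>3 * (a * b)\<close>.\<close>

lemma inert_prime_dvd:
  assumes p: "prime p" and mod: "p mod 3 = 2" and dvd: "int p dvd eis_norm (a, b)"
  shows "int p dvd a \<and> int p dvd b"
proof -
  have pp: "prime (int p)" using p by simp
  have N: "int p dvd a\<^sup>2 - a * b + b\<^sup>2" using dvd by (simp add: eis_norm_def)
  have iff: "int p dvd a \<longleftrightarrow> int p dvd b"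
  proof
    assume "int p dvd a"
    then have "int p dvd (a\<^sup>2 - a * b + b\<^sup>2) - a * (a - b)" using N by simp
    then have "int p dvd b\<^sup>2" by (simp add: power2_eq_square algebra_simps)
    then show "int p dvd b" using pp by (simp add: prime_dvd_power_iff)
  next
    assume "int p dvd b"
    then have "int p dvd (a\<^sup>2 - a * b + b\<^sup>2) - b * (b - a)" using N by simp
    then have "int p dvd a\<^sup>2" by (simp add: power2_eq_square algebra_simps)
    then show "int p dvd a" using pp by (simp add: prime_dvd_power_iff)
  qed
  show ?thesis
  proof (rule ccontr)
    assume "\<not> ?thesis"
    then have a: "\<not> int p dvd a" and b: "\<not> int p dvd - b" using iff by auto
    obtain m where m: "p - 1 = Suc (3 * m)"
    proof
      show "p - 1 = Suc (3 * (p div 3))" using mod by presburger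
    qed
    have fermat: "[x ^ (p - 1) = 1] (mod int p)" if "\<not> int p dvd x" for x
    proof -
      have "coprime x (int p)" using that pp by (metis coprime_commute prime_imp_coprime)
      moreover have "residues (int p)" using prime_gt_1_nat[OF p] by unfold_locales simp
      ultimately have "[x ^ totient (nat (int p)) = 1] (mod int p)"
        by (intro residues.euler_theorem)
      then show ?thesis using p by (simp add: totient_prime)
    qed
    have "a ^ 3 - (- b) ^ 3 = (a + b) * (a\<^sup>2 - a * b + b\<^sup>2)"
      by (simp add: power2_eq_square power3_eq_cube algebra_simps)
    then have "[a ^ 3 = (- b) ^ 3] (mod int p)" using N by (simp add: cong_iff_dvd_diff)
    then have "[(a ^ 3) ^ m = ((- b) ^ 3) ^ m] (mod int p)" by (rule cong_pow)
    then have *: "[a ^ (3 * m) = (- b) ^ (3 * m)] (mod int p)" by (simp only: power_mult)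
    have "[a * a ^ (3 * m) = 1] (mod int p)" using fermat[OF a] by (simp only: m power_Suc)
    also have "[1 = - b * (- b) ^ (3 * m)] (mod int p)"
      using fermat[OF b] by (simp only: m power_Suc cong_sym)
    also have "[- b * (- b) ^ (3 * m) = - b * a ^ (3 * m)] (mod int p)"
      using * by (intro cong_mult cong_refl) (rule cong_sym)
    finally have "int p dvd (a + b) * a ^ (3 * m)"
      by (simp add: cong_iff_dvd_diff algebra_simps)
    then have "int p dvd a + b" using a pp by (metis prime_dvd_mult_iff prime_dvd_power)
    moreover have "3 * (a * b) = (a + b) * (a + b) - (a\<^sup>2 - a * b + b\<^sup>2)"
      by (simp add: power2_eq_square algebra_simps)
    ultimately have "int p dvd 3 * (a * b)" using N by (metis dvd_diff dvd_mult)
    moreover have "\<not> int p dvd 3"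
    proof
      assume "int p dvd 3"
      then have "p dvd 3" by (metis int_dvd_int_iff of_nat_numeral)
      moreover from this have "p \<le> 3" by (simp add: dvd_imp_le)
      then have "p = 2" using mod by presburger
      ultimately show False by simp
    qed
    ultimately show False using a b pp by (simp add: prime_dvd_mult_iff)
  qed
qed

section \<open>Counting Eisenstein integers of given norm\<close>

lemma eis_class_1: "eis_class 1 = {(1, 0), (0, 1), (- 1, - 1)}"
proof (intro equalityI subsetI)
  fix z assume "z \<in> eis_class 1"
  then obtain a b where z: "z = (a, b)" and N: "eis_norm (a, b) = 1" and res: "(a + b) mod 3 = 1"
    by (cases z) (auto simp: eis_class_def eis_res_def)
  have small: "x \<in> {- 1, 0, 1}" if "(2 * y - x)\<^sup>2 + 3 * x\<^sup>2 = 4" for x y :: int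
  proof -
    have "x\<^sup>2 < 2\<^sup>2" using that zero_le_power2[of "2 * y - x"] by (simp only: power2_eq_square; linarith)
    then have "\<bar>x\<bar> < 2" using power2_less_imp_less[of "\<bar>x\<bar>" 2] by simp
    then show ?thesis by auto
  qed
  have "a \<in> {- 1, 0, 1}" "b \<in> {- 1, 0, 1}"
    by (rule small[of b a] small[of a b],
        use N in \<open>simp add: eis_norm_def power2_eq_square algebra_simps\<close>)+
  then show "z \<in> {(1, 0), (0, 1), (- 1, - 1)}" using N res by (auto simp: z eis_norm_def)
qed (auto simp: eis_class_def eis_norm_def eis_res_def)

text \<open>Elements of norm \<open>p * n\<close> are divisible by \<open>p\<close>. The quotient is taken by \<open>- p\<close>, which is 1 modulo
  3, so that the residue is preserved.\<close>

lemma eis_class_prime_mult_inert: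
  assumes p: "prime p" and mod: "p mod 3 = 2"
  shows "card (eis_class (p * n)) = (if p dvd n then card (eis_class (n div p)) else 0)"
proof -
  have p0: "p > 0" using p by (rule prime_gt_0_nat)
  define f where "f = (\<lambda>(a, b). (- int p * a, - int p * b))"
  have norm: "eis_norm (f z) = (int p)\<^sup>2 * eis_norm z" for z
    by (cases z) (simp add: f_def eis_norm_def power2_eq_square algebra_simps)
  have res: "eis_res (f z) = eis_res z" for z
  proof (cases z)
    case (Pair a b)
    have "p = 3 * (p div 3) + 2" using mod by presburger
    then obtain q where "p = 3 * q + 2" by blast
    then have "- int p - 1 = 3 * (- int q - 1)" by simp
    then have "[- int p = 1] (mod 3)" unfolding cong_iff_dvd_diff by (metis dvd_triv_left)
    then have "[- int p * (a + b) = 1 * (a + b)] (mod 3)" by (intro cong_mult cong_refl)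
    moreover have "- int p * a + - int p * b = - int p * (a + b)" by (rule distrib_left[symmetric])
    ultimately show ?thesis by (simp only: Pair f_def eis_res_def cong_def prod.case mult_1)
  qed
  have div: "\<exists>w. z = f w \<and> int n = int p * eis_norm w" if "z \<in> eis_class (p * n)" for z
  proof -
    obtain a b where z: "z = (a, b)" by (cases z)
    have "int p dvd eis_norm (a, b)" using that by (simp add: eis_class_def z)
    then obtain a' b' where "a = int p * a'" "b = int p * b'"
      using inert_prime_dvd[OF p mod] by (meson dvdE)
    then have w: "z = f (- a', - b')" by (simp add: z f_def)
    have "int p * int n = eis_norm z" using that by (simp add: eis_class_def)
    also have "\<dots> = int p * (int p * eis_norm (- a', - b'))"
      by (simp only: w norm power2_eq_square mult.assoc)
    finally show ?thesis using w p0 by auto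
  qed
  show ?thesis
  proof (cases "p dvd n")
    case True
    then obtain m where m: "n = p * m" by blast
    have "eis_class (p * n) = f ` eis_class m"
    proof (intro equalityI subsetI)
      fix z assume z: "z \<in> eis_class (p * n)"
      then obtain w where w: "z = f w" "int n = int p * eis_norm w" using div by blast
      then have "w \<in> eis_class m" using z p0 by (simp add: eis_class_def res m)
      then show "z \<in> f ` eis_class m" using w by blast
    next
      fix z assume "z \<in> f ` eis_class m"
      then show "z \<in> eis_class (p * n)"
        by (auto simp: eis_class_def norm res m power2_eq_square)
    qed
    moreover have "inj f" using p0 by (auto simp: inj_def f_def)
    ultimately have "card (eis_class (p * n)) = card (eis_class m)"
      by (metis card_image inj_on_subset subset_UNIV)
    then show ?thesis using True m p0 by simp
  next
    case False
    then have "eis_class (p * n) = {}"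
      using div by (metis dvd_triv_left equals0I int_dvd_int_iff)
    then show ?thesis using False by simp
  qed
qed

text \<open>With \<open>\<pi> = c + d * \<omega>\<close> of norm \<open>p\<close>, the set counted by \<open>F (p * n)\<close> is the union of the multiples of
  \<open>\<pi>\<close> and of the multiples of its conjugate. Each part is in bijection with the elements of norm
  \<open>n\<close>, and the intersection consists of the multiples of \<open>p\<close>.\<close>

lemma eis_class_prime_mult_split:
  assumes p: "prime p" and mod: "p mod 3 = 1"
  shows "card (eis_class (p * n)) + (if p dvd n then card (eis_class (n div p)) else 0)
       = 2 * card (eis_class n)"
proof -
  have p0: "p > 0" using p by (rule prime_gt_0_nat)
  have pp: "prime (int p)" using p by simp
  obtain c d where "(c, d) \<in> eis_class p" using split_prime_eis_class[OF assms] by (metis surj_pair)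
  then have N: "eis_norm (c, d) = int p" and R: "eis_res (c, d) = 1" by (auto simp: eis_class_def)
  have N': "eis_norm (c - d, - d) = int p" "eis_res (c - d, - d) = 1"
    using N R eis_norm_cnj[of "(c, d)"] eis_res_cnj[of "(c, d)"] by (auto simp: eis_cnj_def)
  let ?f = "eis_mult (c, d)" and ?g = "eis_mult (c - d, - d)" and ?h = "eis_mult (int p, 0)"
  have inj: "inj ?f" "inj ?g" "inj ?h"
    using p0 N N' by (auto intro!: inj_eis_mult simp: eis_norm_def)
  then have card: "card (?f ` S) = card S" "card (?g ` S) = card S" "card (?h ` S) = card S" for S
    by (metis card_image inj_on_subset subset_UNIV)+
  have mem: "eis_mult z w \<in> eis_class (p * m) \<longleftrightarrow> w \<in> eis_class m"
    if "eis_norm z = int p" "eis_res z = 1" for z w m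
    using that p0 by (auto simp: eis_class_def eis_norm_mult eis_res_mult)
  have un: "eis_class (p * n) = ?f ` eis_class n \<union> ?g ` eis_class n"
  proof (intro equalityI subsetI)
    fix z assume z: "z \<in> eis_class (p * n)"
    obtain a b where ab: "z = (a, b)" by (cases z)
    \<comment> \<open>the factors are the coordinates that test divisibility by \<open>\<pi>\<close> and by its conjugate\<close>
    have "(b * c - a * d) * (b * (c - d) - a * (- d))
        = b\<^sup>2 * eis_norm (c, d) - d\<^sup>2 * eis_norm (a, b)"
      by (simp add: eis_norm_def power2_eq_square algebra_simps)
    also have "int p dvd \<dots>" using z by (simp add: N ab eis_class_def)
    finally have "int p dvd b * c - a * d \<or> int p dvd b * (c - d) - a * (- d)"
      using pp by (simp only: prime_dvd_mult_iff)
    then have "(\<exists>w. z = ?f w) \<or> (\<exists>w. z = ?g w)"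
      using eis_prime_dvd[OF pp N] eis_prime_dvd[OF pp N'(1)] unfolding ab by blast
    then show "z \<in> ?f ` eis_class n \<union> ?g ` eis_class n"
      using z mem[OF N R] mem[OF N'] by auto
  qed (use mem[OF N R] mem[OF N'] in auto)
  have fg: "?f (?g w) = ?h w" "?g (?f w) = ?h w" for w
    using eis_mult_cnj[of "(c, d)"] by (simp_all add: eis_cnj_def N flip: eis_mult_assoc)
  \<comment> \<open>\<open>p\<close> does not ramify: neither \<open>d\<close> nor the trace \<open>2 * c - d\<close> of \<open>\<pi>\<close> is divisible by \<open>p\<close>\<close>
  have not_dvd_d: "\<not> int p dvd d \<and> \<not> int p dvd 2 * c - d"
  proof -
    have four: "4 * int p = (2 * c - d)\<^sup>2 + 3 * d\<^sup>2" using eis_norm_four[of c d] N by simp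
    have small: "\<not> int p dvd 4" "\<not> int p dvd 3"
    proof -
      have "p \<noteq> 2" "p \<noteq> 3" using mod by auto
      then have "\<not> p dvd 2 ^ 2" "\<not> p dvd 3"
        using p primes_dvd_imp_eq[of p 2] primes_dvd_imp_eq[of p 3] prime_dvd_power[of p 2 2]
        by auto
      then show "\<not> int p dvd 4" "\<not> int p dvd 3"
        by (simp_all flip: int_dvd_int_iff)
    qed
    have "False" if dvd: "int p dvd d" "int p dvd 2 * c - d"
    proof -
      obtain x y where "d = int p * x" "2 * c - d = int p * y" using dvd by (meson dvdE)
      then have "int p * 4 = int p * (int p * (y\<^sup>2 + 3 * x\<^sup>2))"
        using four by (simp add: power2_eq_square algebra_simps)
      then have "int p * (y\<^sup>2 + 3 * x\<^sup>2) = 4" using p0 by simp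
      then show False using small(1) by (metis dvd_triv_left)
    qed
    moreover have "int p dvd d \<longleftrightarrow> int p dvd 2 * c - d"
    proof
      assume "int p dvd d"
      then have "int p dvd 4 * int p - 3 * (d * d)" by simp
      then have "int p dvd (2 * c - d)\<^sup>2" using four by (simp add: power2_eq_square)
      then show "int p dvd 2 * c - d" using pp by (simp add: prime_dvd_power_iff)
    next
      assume "int p dvd 2 * c - d"
      then have "int p dvd 4 * int p - (2 * c - d) * (2 * c - d)" by simp
      then have "int p dvd 3 * d\<^sup>2" using four by (simp add: power2_eq_square)
      then show "int p dvd d" using pp small by (simp add: prime_dvd_power_iff prime_dvd_mult_iff)
    qed
    ultimately show ?thesis by blast
  qed
  have common: "\<exists>w. z = ?h w" if z: "z \<in> range ?f" "z \<in> range ?g" for z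
  proof -
    obtain u v where uv: "z = ?f u" "z = ?g v" using z by blast
    obtain a b where ab: "z = (a, b)" by (cases z)
    have h: "\<exists>x y. ?h w = (int p * x, int p * y)" for w
      by (cases w) (auto simp: eis_mult_def)
    have "?g z = ?h u" "?f z = ?h v" using fg(2)[of u] fg(1)[of v] uv by metis+
    then obtain x y x' y' where xy: "?g z = (int p * x, int p * y)" and xy': "?f z = (int p * x', int p * y')"
      using h by metis
    have 1: "b * c - a * d = int p * y" and 2: "b * c - b * d + a * d = int p * y'"
      using xy xy' by (simp_all add: ab eis_mult_def algebra_simps)
    have "b * (2 * c - d) = int p * (y + y')" using 1 2 by (simp add: algebra_simps)
    then have b: "int p dvd b" using pp not_dvd_d by (metis dvd_triv_left prime_dvd_mult_iff)
    then have "int p dvd b * c - int p * y" by simp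
    then have "int p dvd a * d" using 1 by (simp add: algebra_simps)
    then have "int p dvd a" using pp not_dvd_d by (simp add: prime_dvd_mult_iff)
    then obtain a' b' where "a = int p * a'" "b = int p * b'" using b by (meson dvdE)
    then show ?thesis unfolding ab by (intro exI[of _ "(a', b')"]) (simp add: eis_mult_def)
  qed
  let ?X = "?f ` eis_class n \<inter> ?g ` eis_class n"
  have X_sub: "\<exists>w. z = ?h w" if zX: "z \<in> ?X" for z
  proof (rule common)
    show "z \<in> range ?f" using zX by (elim IntE imageE) (simp only: rangeI)
    show "z \<in> range ?g" using zX by (elim IntE imageE) (simp only: rangeI)
  qed
  have X_iff: "?h w \<in> ?X \<longleftrightarrow> ?g w \<in> eis_class n \<and> ?f w \<in> eis_class n" for w
    using inj_image_mem_iff[OF inj(1), of "?g w" "eis_class n"]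
      inj_image_mem_iff[OF inj(2), of "?f w" "eis_class n"]
    by (simp only: fg Int_iff)
  have int: "card ?X = (if p dvd n then card (eis_class (n div p)) else 0)"
  proof (cases "p dvd n")
    case True
    then obtain m where m: "n = p * m" by blast
    have X_m: "?h w \<in> ?X \<longleftrightarrow> w \<in> eis_class m" for w
      using X_iff[of w] mem[OF N R, of w m] mem[OF N', of w m] unfolding m by blast
    have "?X = ?h ` eis_class m"
    proof (intro equalityI subsetI)
      fix z assume z: "z \<in> ?X"
      then obtain w where w: "z = ?h w" using X_sub by blast
      then have "w \<in> eis_class m" using z X_m by simp
      then show "z \<in> ?h ` eis_class m" using w by (intro image_eqI)
    next
      fix z assume "z \<in> ?h ` eis_class m"
      then obtain w where "z = ?h w" "w \<in> eis_class m" by (rule imageE)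
      then show "z \<in> ?X" using X_m by simp
    qed
    then show ?thesis using True m p0 card by simp
  next
    case False
    have "?f w \<notin> eis_class n" for w
    proof
      assume "?f w \<in> eis_class n"
      then have "int n = int p * eis_norm w" using N by (simp add: eis_class_def eis_norm_mult)
      then show False using False by (metis dvd_triv_left int_dvd_int_iff)
    qed
    then have no: "?h w \<notin> ?X" for w using X_iff[of w] by blast
    have "?X = {}"
    proof (rule equals0I)
      fix z assume z: "z \<in> ?X"
      then obtain w where "z = ?h w" using X_sub by blast
      then show False using z no[of w] by (simp only:)
    qed
    then show ?thesis using False by simp
  qed
  have "card (?f ` eis_class n) + card (?g ` eis_class n)
      = card (eis_class (p * n)) + card (?f ` eis_class n \<inter> ?g ` eis_class n)"
    unfolding un by (intro card_Un_Int finite_imageI finite_eis_class)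
  then show ?thesis unfolding int card by simp
qed

text \<open>Removing one prime factor at a time, both sides follow the same recurrence; they agree at 1, where
  the three elements are the cube roots of unity.\<close>

theorem card_eis_class:
  assumes "\<not> 3 dvd n"
  shows "int (card (eis_class n)) = 3 * char_sum n"
  using assms
proof (induction n rule: less_induct)
  case (less n)
  have "n \<noteq> 0" using less.prems by (intro notI) simp
  show ?case
  proof (cases "n = 1")
    case True
    then show ?thesis using eis_class_1 char_sum_1 by simp
  next
    case False
    then obtain p m where p: "prime p" and n: "n = p * m" by (metis prime_factor_nat dvdE)
    have m: "m > 0" "m < n" "\<not> 3 dvd m" and p3: "\<not> 3 dvd p"
      using less.prems \<open>n \<noteq> 0\<close> prime_gt_1_nat[OF p] by (auto simp: n)
    have IH: "int (card (eis_class m)) = 3 * char_sum m" using less m by simp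
    have IH': "int (if p dvd m then card (eis_class (m div p)) else 0)
        = 3 * (if p dvd m then char_sum (m div p) else 0)"
    proof (cases "p dvd m")
      case True
      then obtain q where q: "m = p * q" by blast
      moreover have "q \<le> p * q" using prime_gt_0_nat[OF p] by simp
      ultimately have "q < n" using m(2) by linarith
      moreover have "\<not> 3 dvd q" using m(3) q by auto
      ultimately show ?thesis using less.IH q prime_gt_0_nat[OF p] by simp
    qed simp
    have "p mod 3 = 1 \<or> p mod 3 = 2" using p3 by presburger
    then show ?thesis
    proof
      assume mod: "p mod 3 = 1"
      have "int p mod 3 = 1" using mod by presburger
      then have "Legendre (int p) 3 = 1" by (simp add: Legendre_3)
      then have "char_sum (p * m) = 2 * char_sum m - (if p dvd m then char_sum (m div p) else 0)"
        using char_sum_prime_mult[OF p m(1)] by simp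
      moreover have "int (card (eis_class (p * m)))
          + int (if p dvd m then card (eis_class (m div p)) else 0) = 2 * int (card (eis_class m))"
        using eis_class_prime_mult_split[OF p mod, of m] by presburger
      ultimately show ?thesis unfolding n IH IH' by linarith
    next
      assume mod: "p mod 3 = 2"
      have "int p mod 3 = 2" using mod by presburger
      then have "Legendre (int p) 3 = - 1" by (simp add: Legendre_3)
      then show ?thesis
        using eis_class_prime_mult_inert[OF p mod, of m] char_sum_prime_mult[OF p m(1)] IH'
        unfolding n by simp
    qed
  qed
qed

section \<open>Beta sets and hook lengths\<close>

text \<open>The element contributed by a row is its first-column hook length: the length of the row plus the
  number of rows below it.\<close>

fun beta_set :: "nat list \<Rightarrow> nat set" where
  "beta_set [] = {}"
| "beta_set (x # xs) = insert (x + length xs) (beta_set xs)"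

text \<open>The natural numbers outside the beta set, enumerated increasingly by the columns \<open>j\<close>, those to the
  right of the diagram included (\<open>range_gap\<close>). Reading the rim of the diagram from the bottom left
  and numbering its unit steps, the vertical steps have the numbers in the beta set; the horizontal
  step of column \<open>j\<close> comes after \<open>j\<close> horizontal steps and after the vertical steps of the rows of
  length at most \<open>j\<close>.\<close>

definition gap :: "nat list \<Rightarrow> nat \<Rightarrow> nat" where
  "gap xs j = j + length (filter (\<lambda>x. x \<le> j) xs)"

lemma strict_mono_gap: "strict_mono (gap xs)"
proof (rule strict_monoI)
  fix i j :: nat assume "i < j"
  then have "length (filter (\<lambda>x. x \<le> i) xs) \<le> length (filter (\<lambda>x. x \<le> j) xs)"
    by (induction xs) auto
  then show "gap xs i < gap xs j" using \<open>i < j\<close> by (simp add: gap_def)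
qed

lemma gap_eq: "\<forall>x\<in>set xs. x \<le> j \<Longrightarrow> gap xs j = j + length xs"
  by (simp add: gap_def filter_True)

lemma beta_set_less:
  "sorted_wrt (\<ge>) (x # xs) \<Longrightarrow> b \<in> beta_set xs \<Longrightarrow> b < x + length xs"
  by (induction xs) force+

text \<open>Putting a row of length \<open>y\<close> on top leaves the gaps of the columns \<open>j < y\<close> unchanged and shifts those
  of the columns \<open>j \<ge> y\<close> by one, which removes exactly the gap \<open>y + length xs\<close> of column \<open>y\<close>.\<close>

lemma range_gap: "sorted_wrt (\<ge>) xs \<Longrightarrow> range (gap xs) = - beta_set xs"
proof (induction xs)
  case Nil
  then show ?case by (auto simp: gap_def)
next
  case (Cons y xs)
  let ?l = "length xs"
  have IH: "range (gap xs) = - beta_set xs" and le: "\<forall>x\<in>set xs. x \<le> y" using Cons by auto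
  have ge: "gap xs j = j + ?l" "gap (y # xs) j = Suc (j + ?l)" if "y \<le> j" for j
    using that le gap_eq[of xs j] gap_eq[of "y # xs" j] order_trans[of _ y j] by auto
  have lt: "gap (y # xs) j = gap xs j" if "j < y" for j using that by (simp add: gap_def)
  have "range (gap (y # xs)) = range (gap xs) - {gap xs y}"
  proof (intro equalityI subsetI)
    fix c assume "c \<in> range (gap (y # xs))"
    then obtain j where c: "c = gap (y # xs) j" by blast
    show "c \<in> range (gap xs) - {gap xs y}"
    proof (cases "j < y")
      case True
      then show ?thesis using lt c strict_monoD[OF strict_mono_gap[of xs] True] by auto
    next
      case False
      then have "c = gap xs (Suc j)" "c \<noteq> gap xs y" using ge[of j] ge[of "Suc j"] ge[of y] c by auto
      then show ?thesis by auto
    qed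
  next
    fix c assume "c \<in> range (gap xs) - {gap xs y}"
    then obtain j where c: "c = gap xs j" "j \<noteq> y" by blast
    show "c \<in> range (gap (y # xs))"
    proof (cases "j < y")
      case True
      then show ?thesis using lt c by (metis rangeI)
    next
      case False
      then obtain i where "j = Suc i" "y \<le> i" using c(2) by (cases j) auto
      then have "c = gap (y # xs) i" using c ge[of i] ge[of j] by simp
      then show ?thesis by blast
    qed
  qed
  also have "gap xs y = y + ?l" using ge by simp
  finally show ?case using IH by auto
qed

lemma gap_image:
  assumes "sorted_wrt (\<ge>) (x # xs)"
  shows "gap xs ` {..<x} = {..<x + length xs} - beta_set xs"
proof -
  have "gap xs x = x + length xs" using assms by (intro gap_eq) auto
  then have "gap xs ` {..<x} = {..<x + length xs} \<inter> range (gap xs)"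
    using strict_mono_less[OF strict_mono_gap, of xs _ x] by auto
  then show ?thesis using range_gap[of xs] assms by auto
qed

lemma hook_number_Suc: "hook_number (x # xs) (Suc i, j) = hook_number xs (i, j)"
proof -
  have "hook (x # xs) (Suc i, j) = map_prod Suc id ` hook xs (i, j)"
    unfolding hook_def ferrers_def
    by (auto simp: image_iff map_prod_def less_Suc_eq_0_disj nth_Cons split: nat.splits)
  moreover have "inj (map_prod Suc (id :: nat \<Rightarrow> nat))" by (intro prod.inj_map) auto
  ultimately show ?thesis
    unfolding hook_number_def by (metis card_image inj_on_subset subset_UNIV)
qed

text \<open>A hook in the first row joins the vertical step of that row with the horizontal step of column
  \<open>j\<close>; its length is the difference of their numbers. The equation is written additively to avoid
  truncated subtraction.\<close>

lemma hook_number_0: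
  assumes "j < x" and "\<forall>y\<in>set xs. y \<le> x"
  shows "hook_number (x # xs) (0, j) + gap xs j = x + length xs"
proof -
  have "hook (x # xs) (0, j) =
      Pair 0 ` {j..<x} \<union> (\<lambda>i. (Suc i, j)) ` {i. i < length xs \<and> j < xs ! i}"
    using assms(1) by (auto simp: hook_def ferrers_def less_Suc_eq_0_disj image_iff)
  moreover have "card \<dots> = (x - j) + card {i. i < length xs \<and> j < xs ! i}"
    by (subst card_Un_disjoint) (auto simp: card_image inj_on_def)
  moreover have "card {i. i < length xs \<and> j < xs ! i} = length (filter (\<lambda>x. \<not> x \<le> j) xs)"
    by (simp add: length_filter_conv_card not_le)
  moreover have "length (filter (\<lambda>x. x \<le> j) xs) + length (filter (\<lambda>x. \<not> x \<le> j) xs) = length xs"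
    by (rule sum_length_filter_compl)
  ultimately show ?thesis using assms(1) by (simp add: hook_number_def gap_def)
qed

lemma is_core_Cons:
  "is_core t (x # xs) \<longleftrightarrow> is_core t xs \<and> (\<forall>j<x. \<not> t dvd hook_number (x # xs) (0, j))"
proof -
  have "ferrers (x # xs) = Pair 0 ` {..<x} \<union> map_prod Suc id ` ferrers xs"
    by (auto simp: ferrers_def image_iff map_prod_def less_Suc_eq_0_disj nth_Cons split: nat.splits)
  then show ?thesis by (auto simp: is_core_def hook_number_Suc ball_Un)
qed

text \<open>The hook lengths in the row of \<open>b\<close> are the numbers \<open>b - c\<close> with \<open>c < b\<close> a gap. Rows added on top
  only contribute larger elements to the beta set, so the condition for the lower rows does not
  change and the equivalence follows by induction on the list of rows.\<close>

lemma is_core_iff_beta_set: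
  assumes "sorted_wrt (\<ge>) xs"
  shows "is_core t xs \<longleftrightarrow> (\<forall>b\<in>beta_set xs. \<forall>c<b. c \<notin> beta_set xs \<longrightarrow> \<not> t dvd b - c)"
  using assms
proof (induction xs)
  case Nil
  then show ?case by (simp add: is_core_def ferrers_def)
next
  case (Cons x xs)
  let ?b = "x + length xs"
  have less: "b < ?b" if "b \<in> beta_set xs" for b using beta_set_less Cons.prems that by blast
  have "hook_number (x # xs) (0, j) = ?b - gap xs j" if "j < x" for j
    using hook_number_0[OF that, of xs] Cons.prems by auto
  then have "(\<forall>j<x. \<not> t dvd hook_number (x # xs) (0, j)) \<longleftrightarrow> (\<forall>c\<in>gap xs ` {..<x}. \<not> t dvd ?b - c)"
    by auto
  also have "\<dots> \<longleftrightarrow> (\<forall>c<?b. c \<notin> beta_set xs \<longrightarrow> \<not> t dvd ?b - c)"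
    unfolding gap_image[OF Cons.prems] by auto
  finally have "is_core t (x # xs) \<longleftrightarrow>
      (\<forall>b\<in>beta_set xs. \<forall>c<b. c \<notin> beta_set xs \<longrightarrow> \<not> t dvd b - c) \<and>
      (\<forall>c<?b. c \<notin> beta_set xs \<longrightarrow> \<not> t dvd ?b - c)"
    using Cons by (simp add: is_core_Cons)
  also have "\<dots> \<longleftrightarrow> (\<forall>b\<in>beta_set (x # xs). \<forall>c<b. c \<notin> beta_set xs \<longrightarrow> \<not> t dvd b - c)"
    by (simp add: conj_commute)
  also have "\<dots> \<longleftrightarrow>
      (\<forall>b\<in>beta_set (x # xs). \<forall>c<b. c \<notin> beta_set (x # xs) \<longrightarrow> \<not> t dvd b - c)"
  proof -
    have "c \<noteq> ?b" if "b \<in> beta_set (x # xs)" "c < b" for b c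
      using that less[of b] by auto
    then show ?thesis by (metis beta_set.simps(2) insert_iff)
  qed
  finally show ?case .
qed

lemma finite_beta_set: "finite (beta_set xs)"
  by (induction xs) auto

lemma card_beta_set: "sorted_wrt (\<ge>) xs \<Longrightarrow> card (beta_set xs) = length xs"
proof (induction xs)
  case (Cons x xs)
  then have "x + length xs \<notin> beta_set xs" using beta_set_less by blast
  then show ?case using Cons by (simp add: finite_beta_set)
qed simp

text \<open>The rows contribute their lengths plus the numbers \<open>0, 1, 2, \<dots>\<close> of rows below them.\<close>

lemma sum_beta_set:
  "sorted_wrt (\<ge>) xs \<Longrightarrow> \<Sum>(beta_set xs) = sum_list xs + \<Sum>{..<length xs}"
proof (induction xs)
  case (Cons x xs)
  then have "x + length xs \<notin> beta_set xs" using beta_set_less by blast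
  then show ?case using Cons by (simp add: finite_beta_set lessThan_Suc)
qed simp

lemma beta_set_pos: "0 \<notin> set xs \<Longrightarrow> 0 \<notin> beta_set xs"
  by (induction xs) auto

text \<open>The greatest element of the beta set determines the first row, because the cardinality gives the
  number of rows.\<close>

lemma beta_set_inj:
  assumes "sorted_wrt (\<ge>) xs" "sorted_wrt (\<ge>) ys" "beta_set xs = beta_set ys"
  shows "xs = ys"
  using assms
proof (induction xs arbitrary: ys)
  case Nil
  then show ?case by (cases ys) auto
next
  case (Cons x xs)
  then obtain y ys' where ys: "ys = y # ys'" by (cases ys) auto
  have "length (x # xs) = length ys" using Cons.prems by (metis card_beta_set)
  then have len: "length xs = length ys'" using ys by simp
  have max: "Max (beta_set (z # zs)) = z + length zs" if "sorted_wrt (\<ge>) (z # zs)" for z zs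
    using that beta_set_less by (intro Max_eqI) (auto simp: finite_beta_set intro: less_imp_le)
  have "x + length xs = y + length ys'" using max Cons.prems ys by metis
  then have "x = y" using len by simp
  have "x + length xs \<notin> beta_set xs" "x + length xs \<notin> beta_set ys'"
    using beta_set_less Cons.prems ys \<open>x = y\<close> len by (metis less_irrefl)+
  moreover have "insert (x + length xs) (beta_set xs) = insert (x + length xs) (beta_set ys')"
    using Cons.prems(3) ys \<open>x = y\<close> len by simp
  ultimately have "beta_set xs = beta_set ys'" by (metis insert_ident)
  then show ?case using Cons ys \<open>x = y\<close> by auto
qed

lemma beta_set_surj:
  assumes "finite B" "0 \<notin> B"
  shows "\<exists>xs. sorted_wrt (\<ge>) xs \<and> 0 \<notin> set xs \<and> beta_set xs = B"
  using assms
proof (induction B rule: finite_linorder_max_induct)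
  case empty
  then show ?case by (intro exI[of _ "[]"]) auto
next
  case (insert b A)
  then obtain xs where xs: "sorted_wrt (\<ge>) xs" "0 \<notin> set xs" "beta_set xs = A" by auto
  define x where "x = b - length xs"
  have x: "x > 0 \<and> length xs \<le> b \<and> (\<forall>y\<in>set xs. y \<le> x)"
  proof (cases xs)
    case Nil
    then show ?thesis using insert.prems by (auto simp: x_def)
  next
    case (Cons y ys)
    then have "y + length ys < b" "y > 0" "\<forall>z\<in>set xs. z \<le> y" using insert.hyps xs by auto
    then show ?thesis using Cons unfolding x_def by fastforce
  qed
  then show ?case using xs by (intro exI[of _ "x # xs"]) (auto simp: x_def)
qed

section \<open>Partitions that are 3-cores\<close>

definition core3_beta :: "nat \<Rightarrow> nat \<Rightarrow> nat set" where
  "core3_beta u v = (\<lambda>i. 3 * i + 1) ` {..<u} \<union> (\<lambda>i. 3 * i + 2) ` {..<v}"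

lemma core3_beta_parts:
  "{i. 3 * i + 1 \<in> core3_beta u v} = {..<u}" "{i. 3 * i + 2 \<in> core3_beta u v} = {..<v}"
  unfolding core3_beta_def image_def by auto presburger+

lemma finite_core3_beta: "finite (core3_beta u v)"
  by (simp add: core3_beta_def)

text \<open>By \<open>sum_beta_set\<close>, this says that the partition belonging to \<open>core3_beta u v\<close> has size
  \<open>u\<^sup>2 + v\<^sup>2 + v - u * v\<close>.\<close>

lemma sum_core3_beta: "\<Sum>(core3_beta u v) + u * v = (u\<^sup>2 + v\<^sup>2 + v) + \<Sum>{..<card (core3_beta u v)}"
proof -
  let ?f = "\<lambda>i::nat. 3 * i + 1" and ?g = "\<lambda>i::nat. 3 * i + 2"
  have disj: "?f ` {..<u} \<inter> ?g ` {..<v} = {}" by auto presburger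
  have inj: "inj_on ?f S" "inj_on ?g S" for S by (auto simp: inj_on_def)
  have card: "card (core3_beta u v) = u + v"
    unfolding core3_beta_def using disj inj by (simp add: card_Un_disjoint card_image)
  have sum: "\<Sum>(core3_beta u v) = (\<Sum>i<u. ?f i) + (\<Sum>i<v. ?g i)"
    unfolding core3_beta_def using disj inj by (simp add: sum.union_disjoint sum.reindex)
  have sum_f: "2 * (\<Sum>i<u. ?f i) + u = 3 * u\<^sup>2"
    by (induction u) (auto simp: power2_eq_square algebra_simps)
  have sum_g: "2 * (\<Sum>i<v. ?g i) = 3 * v\<^sup>2 + v"
    by (induction v) (auto simp: power2_eq_square algebra_simps)
  have "2 * \<Sum>{..<n} + n = n\<^sup>2" for n :: nat
    by (induction n) (auto simp: lessThan_Suc power2_eq_square algebra_simps)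
  from this[of "u + v"] have "2 * \<Sum>{..<u + v} + (u + v) = u\<^sup>2 + 2 * (u * v) + v\<^sup>2"
    by (simp add: power2_sum)
  with sum_f sum_g show ?thesis unfolding card sum by linarith
qed

lemma down_closed_eq_lessThan:
  fixes S :: "nat set"
  assumes "finite S" "\<And>i. Suc i \<in> S \<Longrightarrow> i \<in> S"
  shows "\<exists>u. S = {..<u}"
proof -
  have down: "i \<in> S" if "j \<in> S" "i \<le> j" for i j
    using that(2,1) by (induction rule: inc_induct) (auto intro: assms(2))
  define u where "u = (LEAST i. i \<notin> S)"
  have "\<exists>i. i \<notin> S" using assms(1) by (rule ex_new_if_finite[OF infinite_UNIV_nat])
  then have "u \<notin> S" unfolding u_def by (rule LeastI_ex)
  moreover have "i \<in> S" if "i < u" for i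
    using not_less_Least[of i "\<lambda>i. i \<notin> S"] that by (simp add: u_def)
  ultimately have "S = {..<u}" using down by (metis lessThan_iff not_le set_eq_iff)
  then show ?thesis ..
qed

text \<open>Closure under \<open>b \<mapsto> b - 3\<close> makes each residue class of the set an initial segment of that class, and
  the class of 0 is empty because 0 is excluded. The first two conditions characterise the beta sets
  of partitions.\<close>

lemma core3_beta_iff:
  "finite B \<and> 0 \<notin> B \<and> (\<forall>b\<in>B. \<forall>c<b. c \<notin> B \<longrightarrow> \<not> 3 dvd b - c) \<longleftrightarrow> (\<exists>u v. B = core3_beta u v)"
proof
  assume B: "finite B \<and> 0 \<notin> B \<and> (\<forall>b\<in>B. \<forall>c<b. c \<notin> B \<longrightarrow> \<not> 3 dvd b - c)"
  have step: "b \<in> B" if "b + 3 \<in> B" for b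
    using B[THEN conjunct2, THEN conjunct2, rule_format, OF that, of b] by auto
  have "\<exists>u. {i. 3 * i + r \<in> B} = {..<u}" for r
  proof (rule down_closed_eq_lessThan)
    have "inj (\<lambda>i. 3 * i + r)" by (auto simp: inj_def)
    then show "finite {i. 3 * i + r \<in> B}"
      using finite_vimageI[of B "\<lambda>i. 3 * i + r"] B by (simp add: vimage_def)
  next
    fix i assume "Suc i \<in> {i. 3 * i + r \<in> B}"
    then show "i \<in> {i. 3 * i + r \<in> B}" using step[of "3 * i + r"] by (simp add: algebra_simps)
  qed
  then obtain u v where u: "{i. 3 * i + 1 \<in> B} = {..<u}" and v: "{i. 3 * i + 2 \<in> B} = {..<v}"
    by metis
  have zero: "3 * i \<notin> B" for i
  proof (induction i)
    case (Suc i)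
    then show ?case using step[of "3 * i"] by (auto simp: add.commute)
  qed (use B in simp)
  have "b \<in> B \<longleftrightarrow> b \<in> core3_beta u v" for b
  proof -
    have "b = 3 * (b div 3) \<or> b = 3 * (b div 3) + 1 \<or> b = 3 * (b div 3) + 2" by presburger
    then obtain i where "b = 3 * i \<or> b = 3 * i + 1 \<or> b = 3 * i + 2" by blast
    moreover have "3 * i \<notin> core3_beta u v" unfolding core3_beta_def by auto presburger+
    moreover have "3 * i + 1 \<in> B \<longleftrightarrow> 3 * i + 1 \<in> core3_beta u v"
      using u core3_beta_parts(1)[of u v] by blast
    moreover have "3 * i + 2 \<in> B \<longleftrightarrow> 3 * i + 2 \<in> core3_beta u v"
      using v core3_beta_parts(2)[of v u] core3_beta_parts(2)[of u v] by blast
    ultimately show ?thesis using zero[of i] by metis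
  qed
  then show "\<exists>u v. B = core3_beta u v" by blast
next
  assume "\<exists>u v. B = core3_beta u v"
  then obtain u v where B: "B = core3_beta u v" by blast
  have "c \<in> B" if "b \<in> B" "c < b" "3 dvd b - c" for b c
  proof -
    obtain k where "b - c = 3 * k" using \<open>3 dvd b - c\<close> by blast
    then have "b = c + 3 * k" using \<open>c < b\<close> by simp
    have "\<exists>r\<in>{1, 2}. \<exists>w i. i < w \<and> b = 3 * i + r \<and> (\<forall>i<w. 3 * i + r \<in> B)"
      using \<open>b \<in> B\<close> unfolding B core3_beta_def by fastforce
    then obtain r w i where r: "r \<in> {1, 2}" "i < w" "b = 3 * i + r" "\<forall>i<w. 3 * i + r \<in> B" by blast
    then have "c = 3 * (i - k) + r" "i - k < w" using \<open>b = c + 3 * k\<close> by auto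
    with r(4) show ?thesis by blast
  qed
  moreover have "0 \<notin> B" by (auto simp: B core3_beta_def)
  ultimately show "finite B \<and> 0 \<notin> B \<and> (\<forall>b\<in>B. \<forall>c<b. c \<notin> B \<longrightarrow> \<not> 3 dvd b - c)"
    using finite_core3_beta B by blast
qed

lemma core_count_3: "core_count 3 k = card {(u, v). u\<^sup>2 + v\<^sup>2 + v = k + u * v}"
proof -
  let ?C = "{xs \<in> partitions k. is_core 3 xs}" and ?P = "{(u, v). u\<^sup>2 + v\<^sup>2 + v = k + u * v}"
  have "beta_set ` ?C = case_prod core3_beta ` ?P"
  proof (intro equalityI subsetI)
    fix B assume "B \<in> beta_set ` ?C"
    then obtain xs where xs: "sorted_wrt (\<ge>) xs" "0 \<notin> set xs" "sum_list xs = k" "is_core 3 xs"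
      and B: "B = beta_set xs" by (auto simp: partitions_def)
    have "\<exists>u v. B = core3_beta u v"
      using xs finite_beta_set beta_set_pos is_core_iff_beta_set
      unfolding core3_beta_iff[symmetric] B by blast
    then obtain u v where uv: "B = core3_beta u v" by blast
    have "\<Sum>B = k + \<Sum>{..<card B}" using xs B by (simp add: sum_beta_set card_beta_set)
    then have "u\<^sup>2 + v\<^sup>2 + v = k + u * v" using sum_core3_beta[of u v] uv by simp
    then show "B \<in> case_prod core3_beta ` ?P" using uv by auto
  next
    fix B assume "B \<in> case_prod core3_beta ` ?P"
    then obtain u v where uv: "B = core3_beta u v" "u\<^sup>2 + v\<^sup>2 + v = k + u * v" by auto
    then have B: "finite B" "0 \<notin> B" "\<forall>b\<in>B. \<forall>c<b. c \<notin> B \<longrightarrow> \<not> 3 dvd b - c"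
      using core3_beta_iff[of B] by blast+
    obtain xs where xs: "sorted_wrt (\<ge>) xs" "0 \<notin> set xs" "beta_set xs = B"
      using beta_set_surj[OF B(1,2)] by blast
    then have "is_core 3 xs" using B(3) is_core_iff_beta_set by blast
    moreover have "sum_list xs = k"
      using sum_beta_set[OF xs(1)] card_beta_set[OF xs(1)] sum_core3_beta[of u v] uv xs(3) by simp
    ultimately show "B \<in> beta_set ` ?C" using xs by (auto simp: partitions_def)
  qed
  moreover have "inj_on beta_set ?C" by (auto simp: inj_on_def partitions_def intro: beta_set_inj)
  moreover have "inj_on (case_prod core3_beta) ?P"
    by (rule inj_onI, clarify) (metis core3_beta_parts lessThan_eq_iff)
  ultimately have "card ?C = card ?P"
    using card_image[of beta_set ?C] card_image[of "case_prod core3_beta" ?P] by simp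
  then show ?thesis by (simp only: core_count_def)
qed

section \<open>3-cores and the divisor sum\<close>

text \<open>Multiplication by \<open>\<omega>\<close>.\<close>

definition eis_rot :: "int \<times> int \<Rightarrow> int \<times> int" where
  "eis_rot = (\<lambda>(a, b). (- b, a - b))"

text \<open>The linear conditions describe the open sector of angle \<open>2 * \<pi> / 3\<close> between the arguments
  \<open>- \<pi> / 6\<close> and \<open>\<pi> / 2\<close>. It is a fundamental domain for multiplication by \<open>\<omega>\<close>, up to its boundary
  rays.\<close>

definition eis_sector :: "nat \<Rightarrow> (int \<times> int) set" where
  "eis_sector n = {(a, b) \<in> eis_class n. 0 < a + b \<and> 0 < 2 * a - b}"

lemma eis_rot_rot_rot: "eis_rot (eis_rot (eis_rot z)) = z"
  by (cases z) (simp add: eis_rot_def)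

lemma eis_rot_in_eis_class_iff: "eis_rot z \<in> eis_class n \<longleftrightarrow> z \<in> eis_class n"
proof (cases z)
  case (Pair a b)
  have "eis_norm (- b, a - b) = eis_norm (a, b)"
    by (simp add: eis_norm_def power2_eq_square algebra_simps)
  moreover have "(- b + (a - b)) mod 3 = (a + b) mod 3" by presburger
  ultimately show ?thesis by (simp add: Pair eis_rot_def eis_class_def eis_res_def)
qed

text \<open>The three rotated sectors are disjoint and leave out only their boundary rays. On these one of
  \<open>a + b\<close>, \<open>2 * a - b\<close> and \<open>2 * b - a\<close> vanishes, but modulo 3 all three are multiples of the nonzero
  residue \<open>a + b\<close>.\<close>

lemma card_eis_class_eq_sector: "card (eis_class n) = 3 * card (eis_sector n)"
proof -
  let ?E = "eis_class n" and ?S = "eis_sector n"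
  let ?S1 = "{z. eis_rot z \<in> ?S}" and ?S2 = "{z. eis_rot (eis_rot z) \<in> ?S}"
  have sub: "?S \<subseteq> ?E" by (auto simp: eis_sector_def)
  then have sub': "?S1 \<subseteq> ?E" "?S2 \<subseteq> ?E" using eis_rot_in_eis_class_iff by blast+
  have sign: "a + b \<noteq> 0" "2 * a - b \<noteq> 0" "2 * b - a \<noteq> 0" if "(a, b) \<in> ?E" for a b
    using that by (simp_all add: eis_class_def eis_res_def) presburger+
  have mem: "(a, b) \<in> ?S \<longleftrightarrow> 0 < a + b \<and> 0 < 2 * a - b"
    "(a, b) \<in> ?S1 \<longleftrightarrow> 0 < a - 2 * b \<and> 0 < - (a + b)"
    "(a, b) \<in> ?S2 \<longleftrightarrow> 0 < b - 2 * a \<and> 0 < 2 * b - a" if "(a, b) \<in> ?E" for a b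
    using that eis_rot_in_eis_class_iff[of "(a, b)" n] eis_rot_in_eis_class_iff[of "eis_rot (a, b)" n]
    by (auto simp: eis_sector_def eis_rot_def)
  have "z \<in> ?S \<union> ?S1 \<union> ?S2" if "z \<in> ?E" for z
  proof (cases z)
    case (Pair a b)
    then have ab: "(a, b) \<in> ?E" using that by simp
    have "0 < a + b \<and> 0 < 2 * a - b \<or> 0 < a - 2 * b \<and> 0 < - (a + b) \<or> 0 < b - 2 * a \<and> 0 < 2 * b - a"
      using sign[OF ab] by linarith
    then show ?thesis unfolding Pair Un_iff mem[OF ab] by blast
  qed
  then have un: "?E = ?S \<union> ?S1 \<union> ?S2" using sub sub' by blast
  have "\<not> (z \<in> ?S \<and> z \<in> ?S1)" "\<not> (z \<in> ?S \<and> z \<in> ?S2)" "\<not> (z \<in> ?S1 \<and> z \<in> ?S2)" if "z \<in> ?E" for z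
  proof -
    obtain a b where z: "z = (a, b)" by (cases z)
    then have ab: "(a, b) \<in> ?E" using that by simp
    show "\<not> (z \<in> ?S \<and> z \<in> ?S1)" "\<not> (z \<in> ?S \<and> z \<in> ?S2)" "\<not> (z \<in> ?S1 \<and> z \<in> ?S2)"
      unfolding z mem[OF ab] by linarith+
  qed
  then have disj: "?S \<inter> ?S1 = {}" "(?S \<union> ?S1) \<inter> ?S2 = {}" using sub sub' by blast+
  have fin: "finite ?S" "finite ?S1" "finite ?S2"
    using sub sub' finite_eis_class[of n] by (meson finite_subset)+
  have "bij_betw eis_rot ?S1 ?S"
    by (intro bij_betwI[where g = "\<lambda>z. eis_rot (eis_rot z)"]) (auto simp: eis_rot_rot_rot)
  moreover have "bij_betw eis_rot ?S2 ?S1"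
    by (intro bij_betwI[where g = "\<lambda>z. eis_rot (eis_rot z)"]) (auto simp: eis_rot_rot_rot)
  ultimately have "card ?S1 = card ?S" "card ?S2 = card ?S" using bij_betw_same_card by metis+
  moreover have "card ?E = card ?S + card ?S1 + card ?S2"
    unfolding un using fin disj by (simp add: card_Un_disjoint)
  ultimately show ?thesis by simp
qed

text \<open>For \<open>a = u + v + 1\<close> and \<open>b = 2 * u - v\<close> one has \<open>a + b = 3 * u + 1\<close> and \<open>2 * a - b = 3 * v + 2\<close>.
  Hence the residue condition makes \<open>u\<close> and \<open>v\<close> integers, and the sector conditions say that they
  are nonnegative.\<close>

lemma card_eis_sector: "card (eis_sector (3 * k + 1)) = card {(u, v). u\<^sup>2 + v\<^sup>2 + v = k + u * v}"
proof -
  define f :: "nat \<times> nat \<Rightarrow> int \<times> int"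
    where "f = (\<lambda>(u, v). (int u + int v + 1, 2 * int u - int v))"
  let ?P = "{(u, v). u\<^sup>2 + v\<^sup>2 + v = k + u * v}"
  have norm: "eis_norm (int u + int v + 1, 2 * int u - int v) = int (3 * k + 1) \<longleftrightarrow> (u, v) \<in> ?P" for u v
  proof -
    have "eis_norm (int u + int v + 1, 2 * int u - int v)
        = 3 * (int (u\<^sup>2 + v\<^sup>2 + v) - int (u * v)) + 1"
      by (simp add: eis_norm_def power2_eq_square algebra_simps)
    then have "eis_norm (int u + int v + 1, 2 * int u - int v) = int (3 * k + 1)
        \<longleftrightarrow> int (u\<^sup>2 + v\<^sup>2 + v) = int (k + u * v)" by (simp; linarith)
    then show ?thesis by (simp only: of_nat_eq_iff mem_Collect_eq prod.case)
  qed
  have "eis_sector (3 * k + 1) = f ` ?P"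
  proof (intro equalityI subsetI)
    fix z assume z: "z \<in> eis_sector (3 * k + 1)"
    obtain a b where ab: "z = (a, b)" by (cases z)
    have res: "(a + b) mod 3 = 1" and pos: "0 < a + b" "0 < 2 * a - b"
      and N: "eis_norm (a, b) = int (3 * k + 1)"
      using z by (auto simp: ab eis_sector_def eis_class_def eis_res_def)
    obtain x where x: "a + b = 3 * x + 1" using res by (metis mult_div_mod_eq)
    have "0 < 3 * x + 1" "0 < 3 * (a - x - 1) + 2" using pos x by simp_all
    then have xy: "0 \<le> x" "0 \<le> a - x - 1" by presburger+
    define u v where "u = nat x" and "v = nat (a - x - 1)"
    have uv: "a = int u + int v + 1" "b = 2 * int u - int v" using xy x by (auto simp: u_def v_def)
    then have "(u, v) \<in> ?P" using N norm[of u v] by simp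
    then show "z \<in> f ` ?P" unfolding ab uv by (intro image_eqI[of _ _ "(u, v)"]) (auto simp: f_def)
  next
    fix z assume "z \<in> f ` ?P"
    then obtain u v where z: "z = (int u + int v + 1, 2 * int u - int v)" and uv: "(u, v) \<in> ?P"
      by (auto simp: f_def)
    have "(int u + int v + 1 + (2 * int u - int v)) mod 3 = 1" by presburger
    then show "z \<in> eis_sector (3 * k + 1)"
      using norm uv by (auto simp: z eis_sector_def eis_class_def eis_res_def)
  qed
  moreover have "inj f" by (rule injI) (auto simp: f_def)
  ultimately show ?thesis using card_image[OF inj_on_subset[OF _ subset_UNIV], of f ?P] by simp
qed

text \<open>The divisor formula of Granville and Ono for the number of 3-cores.\<close>

theorem core_count_3_eq_char_sum: "int (core_count 3 k) = char_sum (3 * k + 1)"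
proof -
  have "\<not> 3 dvd 3 * k + 1" by presburger
  then show ?thesis
    using card_eis_class[of "3 * k + 1"]
    by (simp add: core_count_3 card_eis_class_eq_sector flip: card_eis_sector)
qed

lemma divisor_sums_cong_char_sum:
  fixes l s n :: nat
  assumes "odd l" "3 ^ s dvd l" "\<not> 3 dvd n"
  shows "[(\<Sum>d | d dvd n. Legendre (int d) 3 * int d ^ (2 * l)) = char_sum n] (mod 3 ^ (s + 1))"
    and "[(\<Sum>d | d dvd n. int d ^ l) = char_sum n] (mod 3 ^ (s + 1))"
proof -
  have d: "\<not> 3 dvd d" if "d dvd n" for d using assms(3) that by (meson dvd_trans)
  have "[Legendre (int d) 3 * int d ^ (2 * l) = Legendre (int d) 3 * 1] (mod 3 ^ (s + 1))"
    if "d dvd n" for d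
    using odd_power_cong_Legendre_3(2)[OF assms(1,2) d[OF that]] by (intro cong_mult cong_refl)
  then show "[(\<Sum>d | d dvd n. Legendre (int d) 3 * int d ^ (2 * l)) = char_sum n] (mod 3 ^ (s + 1))"
    unfolding char_sum_def by (intro cong_sum) simp
  show "[(\<Sum>d | d dvd n. int d ^ l) = char_sum n] (mod 3 ^ (s + 1))"
    unfolding char_sum_def using odd_power_cong_Legendre_3(1)[OF assms(1,2)] d
    by (intro cong_sum) blast
qed

theorem theorem2p1:
  fixes l s k :: nat
  assumes "odd l" and "3 ^ s dvd l" and "\<not> 3 ^ (s + 1) dvd l"
  shows "[(\<Sum>d | d dvd 3 * k + 2. Legendre (int d) 3 * int d ^ (2 * l)) = 0] (mod 3 ^ (s + 1))
    \<and> [(\<Sum>d | d dvd 3 * k + 1. Legendre (int d) 3 * int d ^ (2 * l)) = int (core_count 3 k)]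
        (mod 3 ^ (s + 1))
    \<and> [(\<Sum>d | d dvd 3 * k + 2. int d ^ l) = 0] (mod 3 ^ (s + 1))
    \<and> [(\<Sum>d | d dvd 3 * k + 1. int d ^ l) = int (core_count 3 k)] (mod 3 ^ (s + 1))"
proof -
  have "\<not> 3 dvd 3 * k + 1" "\<not> 3 dvd 3 * k + 2" by presburger+
  note sums = divisor_sums_cong_char_sum[OF assms(1,2) this(1)]
    divisor_sums_cong_char_sum[OF assms(1,2) this(2)]
  have "(3 * k + 2) mod 3 = 2" by presburger
  then have "char_sum (3 * k + 2) = 0" by (rule char_sum_eq_0)
  then show ?thesis using sums by (simp add: core_count_3_eq_char_sum)
qed

end
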